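(* Let $q$ be a prime power, $m\ge 1$ an integer, and $f:\mathbb{F}_q^m\to\mathbb{F}_q$ a function such that for every $\omega'\in\mathbb{F}_q^m$ there is some $\mathbf{x}\in\mathbb{F}_q^m\setminus\{\mathbf{0}\}$ with $f(\mathbf{x})\neq\omega'\cdot\mathbf{x}$. Let $u\in\mathbb{F}_q$ with $u\neq 0$, let $\mathbf{v}\in\mathbb{F}_q^m$ with $\mathbf{v}\neq\mathbf{0}$, and put $\omega=-\frac{1}{u}\mathbf{v}$. Then the codeword $\mathbf{c}(u,\mathbf{v})$ is minimal in $\mathcal{C}_f$ if and only if there exists a basis $\{\alpha_1,\dots,\alpha_m\}$ of $\mathbb{F}_q^m$ such that $f(\alpha_i)=\omega\cdot\alpha_i$ for all $1\le i\le m$.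
   Context: For $\mathbf{x},\mathbf{y}\in\mathbb{F}_q^m$, $\mathbf{x}\cdot\mathbf{y}=\sum_i x_iy_i$. For $u\in\mathbb{F}_q$ and $\mathbf{v}\in\mathbb{F}_q^m$ put $\mathbf{c}(u,\mathbf{v})=(uf(\mathbf{x})+\mathbf{v}\cdot\mathbf{x})_{\mathbf{x}\in\mathbb{F}_q^m\setminus\{\mathbf{0}\}}\in\mathbb{F}_q^{q^m-1}$, and let $\mathcal{C}_f=\{\mathbf{c}(u,\mathbf{v}) : u\in\mathbb{F}_q,\ \mathbf{v}\in\mathbb{F}_q^m\}$; under the assumption on $f$ this is a $[q^m-1,m+1]_q$ linear code. The support of a vector is the set of its coordinate positions with nonzero entry; $\mathbf{b}\preceq\mathbf{c}$ ($\mathbf{c}$ covers $\mathbf{b}$) means that the support of $\mathbf{b}$ is contained in the support of $\mathbf{c}$. A codeword $\mathbf{c}$ of a linear code $\mathcal{C}$ is minimal in $\mathcal{C}$ if for every $\mathbf{b}\in\mathcal{C}$, $\mathbf{b}\preceq\mathbf{c}$ implies $\mathbf{b}=a\mathbf{c}$ for some $a\in\mathbb{F}_q$. *)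

theory Defs
  imports "HOL-Analysis.Analysis"
begin

(* A finite field F_q is a type 'a of classes field and finite, with q = CARD('a).
   The space F_q^m is the type 'a ^ 'm with m = CARD('m), so m \<ge> 1.
   The dot product is the library's scalar_product. *)

text \<open>The index set of the coordinates of the code: the nonzero vectors of \<open>F_q^m\<close>.\<close>

typedef (overloaded) ('a, 'm) nonzero_vec = "{x :: ('a :: field) ^ ('m :: finite). x \<noteq> 0}"
  by (rule exI[of _ 1]) simp

instance nonzero_vec :: ("{field, finite}", finite) finite
proof
  have "inj (Rep_nonzero_vec :: ('a, 'b) nonzero_vec \<Rightarrow> 'a ^ 'b)"
    by (simp add: inj_def Rep_nonzero_vec_inject)
  then show "finite (UNIV :: ('a :: {field, finite}, 'b :: finite) nonzero_vec set)"
    by (metis finite finite_imageD)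
qed

lemma CARD_nonzero_vec:
  "CARD(('a :: {field, finite}, 'm :: finite) nonzero_vec) = CARD('a) ^ CARD('m) - 1"
proof -
  have "CARD(('a, 'm) nonzero_vec) = card {x :: 'a ^ 'm. x \<noteq> 0}"
    by (rule type_definition.card[OF type_definition_nonzero_vec])
  also have "{x :: 'a ^ 'm. x \<noteq> 0} = UNIV - {0}"
    by auto
  finally show ?thesis
    by (simp add: card_Diff_singleton)
qed

definition support :: "('a :: zero) ^ 'n \<Rightarrow> 'n set" where
  "support c = {i. c $ i \<noteq> 0}"

definition covered_by :: "('a :: zero) ^ 'n \<Rightarrow> 'a ^ 'n \<Rightarrow> bool" where
  "covered_by b c \<longleftrightarrow> support b \<subseteq> support c"

definition minimal_codeword :: "(('a :: field) ^ 'n) set \<Rightarrow> 'a ^ 'n \<Rightarrow> bool" where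
  "minimal_codeword C c \<longleftrightarrow>
     c \<in> C \<and> (\<forall>b\<in>C. covered_by b c \<longrightarrow> (\<exists>a. b = a *s c))"

definition codeword ::
  "('a ^ 'm \<Rightarrow> 'a) \<Rightarrow> 'a \<Rightarrow> 'a ^ 'm \<Rightarrow> ('a :: {field, finite}) ^ ('a, 'm :: finite) nonzero_vec" where
  "codeword f u v = (\<chi> x. u * f (Rep_nonzero_vec x) + scalar_product v (Rep_nonzero_vec x))"

definition code_of ::
  "('a ^ 'm \<Rightarrow> 'a) \<Rightarrow> (('a :: {field, finite}) ^ ('a, 'm :: finite) nonzero_vec) set" where
  "code_of f = {codeword f u v | u v. True}"

lemma subspace_code_of: "vec.subspace (code_of f)"
proof (rule vec.subspaceI)
  have "codeword f 0 0 = 0"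
    by (simp add: codeword_def scalar_product_def vec_eq_iff)
  then show "0 \<in> code_of f"
    unfolding code_of_def by (metis (mono_tags, lifting) mem_Collect_eq)
next
  fix b c assume "b \<in> code_of f" "c \<in> code_of f"
  then obtain u v u' v' where "b = codeword f u v" "c = codeword f u' v'"
    unfolding code_of_def by blast
  then have "b + c = codeword f (u + u') (v + v')"
    by (simp add: codeword_def scalar_product_def vec_eq_iff algebra_simps sum.distrib)
  then show "b + c \<in> code_of f"
    unfolding code_of_def by blast
next
  fix a c assume "c \<in> code_of f"
  then obtain u v where "c = codeword f u v"
    unfolding code_of_def by blast
  then have "a *s c = codeword f (a * u) (a *s v)"
    by (simp add: codeword_def scalar_product_def vec_eq_iff algebra_simps sum_distrib_left)
  then show "a *s c \<in> code_of f"
    unfolding code_of_def by blast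
qed

end

theory Submission
  imports Defs
begin

text \<open>The codeword \<open>c(u, v)\<close> vanishes exactly on \<open>Z = {x \<noteq> 0. f x = \<omega> \<cdot> x}\<close>. A vector \<open>w\<close> orthogonal to
  \<open>Z\<close> yields the codeword \<open>c(0, w)\<close> covered by \<open>c(u, v)\<close>, and nonlinearity of \<open>f\<close> forbids
  proportionality unless \<open>w = 0\<close>; so minimality forces \<open>Z\<close> to span. Conversely, \<open>c(u', v')\<close> is covered
  by \<open>c(u, v)\<close> only if \<open>u' \<omega> + v'\<close> is orthogonal to \<open>Z\<close>, hence zero when \<open>Z\<close> spans.\<close>

lemma scalar_product_simps:
  fixes v w x y :: "'a::comm_ring_1 ^ 'n"
  shows scalar_product_add_left: "scalar_product (v + w) x = scalar_product v x + scalar_product w x"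
    and scalar_product_diff_left: "scalar_product (v - w) x = scalar_product v x - scalar_product w x"
    and scalar_product_scale_left: "scalar_product (a *s v) x = a * scalar_product v x"
    and scalar_product_add_right: "scalar_product v (x + y) = scalar_product v x + scalar_product v y"
    and scalar_product_scale_right: "scalar_product v (a *s x) = a * scalar_product v x"
    and scalar_product_zero_left: "scalar_product 0 x = 0"
    and scalar_product_zero_right: "scalar_product v 0 = 0"
  by (simp_all add: scalar_product_def algebra_simps sum.distrib sum_subtractf sum_distrib_left)

lemma scalar_product_axis:
  fixes v :: "'a::comm_ring_1 ^ 'n"
  shows "scalar_product v (axis i 1) = v $ i"
  by (simp add: scalar_product_def axis_def if_distrib cong: if_cong)

text \<open>The vectors orthogonal to \<open>v\<close> form a subspace, so they include the whole
  span; pairing \<open>v\<close> with the unit vectors then reads off its coordinates.\<close>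

lemma scalar_product_eq_zero_on_spanning_set:
  fixes v :: "'a::field ^ 'n"
  assumes "\<And>x. x \<in> S \<Longrightarrow> scalar_product v x = 0" and "vec.span S = UNIV"
  shows "v = 0"
proof -
  have "scalar_product v x = 0" if "x \<in> vec.span S" for x
    using that
    by (induction rule: vec.span_induct_alt)
      (simp_all add: assms(1) scalar_product_simps)
  then show ?thesis
    by (metis UNIV_I assms(2) scalar_product_axis vec_eq_iff zero_index)
qed

text \<open>Some endomorphism kills \<open>S\<close> but fixes a vector \<open>y\<close> outside its
  span. A row of its matrix at which \<open>y\<close> has a nonzero coordinate serves as
  \<open>w\<close>.\<close>

lemma ex_orthogonal_if_not_spanning:
  fixes S :: "('a::field ^ 'n) set"
  assumes "vec.span S \<noteq> UNIV"
  obtains w where "w \<noteq> 0" "\<And>x. x \<in> S \<Longrightarrow> scalar_product w x = 0"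
proof -
  obtain B where B: "B \<subseteq> S" "vec.independent B" "S \<subseteq> vec.span B"
    by (rule vec.maximal_independent_subset)
  obtain y where y: "y \<notin> vec.span S"
    using assms by blast
  then have y': "y \<notin> vec.span B"
    using vec.span_mono[OF B(1)] by blast
  then have indep: "vec.independent (insert y B)"
    using B(2) by (simp add: vec.independent_insertI)
  obtain g :: "'a ^ 'n \<Rightarrow> 'a ^ 'n" where lin: "Vector_Spaces.linear (*s) (*s) g"
    and g: "\<forall>x\<in>insert y B. g x = (if x = y then y else 0)"
    using vec.linear_independent_extend[OF indep, of "\<lambda>x. if x = y then y else 0"] by (elim exE conjE)
  have "y \<noteq> 0"
    using y vec.span_zero by blast
  then obtain i where i: "y $ i \<noteq> 0"
    by (metis vec_eq_iff zero_index)
  \<comment> \<open>Row \<open>i\<close> of the matrix represents the linear functional that takes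
    \<open>x\<close> to coordinate \<open>i\<close> of \<open>g x\<close>.\<close>
  have sp: "scalar_product (matrix g $ i) x = g x $ i" for x
    using matrix_works[OF lin, of x]
    by (metis (no_types) matrix_vector_mult_def scalar_product_def vec_lambda_beta)
  have "g x = 0" if "x \<in> B" for x
    using that g y' vec.span_base by fastforce
  then have "g x = 0" if "x \<in> S" for x
    using that B(3) vec.linear_eq_0_on_span[OF lin] by blast
  then have "scalar_product (matrix g $ i) x = 0" if "x \<in> S" for x
    using that sp by simp
  moreover have "scalar_product (matrix g $ i) y = y $ i"
    using sp g by simp
  then have "matrix g $ i \<noteq> 0"
    using i by (metis scalar_product_zero_left)
  ultimately show ?thesis
    using that by blast
qed

text \<open>A maximal independent subset of \<open>S\<close> spans whatever \<open>S\<close> spans.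
  Its size is then the dimension \<open>CARD('n)\<close>, so the coordinate type itself can index
  it.\<close>

lemma ex_indexed_basis_if_spanning:
  fixes S :: "('a::field ^ 'n) set"
  assumes "vec.span S = UNIV"
  obtains \<alpha> :: "'n \<Rightarrow> 'a ^ 'n"
  where "inj \<alpha>" "vec.independent (range \<alpha>)" "vec.span (range \<alpha>) = UNIV" "range \<alpha> \<subseteq> S"
proof -
  obtain B where B: "B \<subseteq> S" "vec.independent B" "S \<subseteq> vec.span B"
    by (rule vec.maximal_independent_subset)
  have span: "vec.span B = UNIV"
    using B(3) assms vec.span_mono[of S "vec.span B"] by (auto simp: vec.span_span)
  then have "card B = CARD('n)" "finite B"
    using vec.indep_card_eq_dim_span[OF B(2)] vec_dim_card by auto
  then obtain \<alpha> :: "'n \<Rightarrow> 'a ^ 'n" where "bij_betw \<alpha> UNIV B"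
    using finite_same_card_bij[of "UNIV :: 'n set" B] by auto
  then show ?thesis
    using that[of \<alpha>] B span by (auto simp: bij_betw_def)
qed

lemma codeword_nth_Abs:
  "x \<noteq> 0 \<Longrightarrow> codeword f u v $ Abs_nonzero_vec x = u * f x + scalar_product v x"
  by (simp add: codeword_def Abs_nonzero_vec_inverse)

text \<open>Complementation turns inclusion of supports into reverse inclusion of zero sets, and
  every position is \<open>Abs_nonzero_vec x\<close> for some nonzero \<open>x\<close>.\<close>

lemma covered_by_codeword_iff:
  "covered_by (codeword f u' v') (codeword f u v) \<longleftrightarrow>
    (\<forall>x. x \<noteq> 0 \<longrightarrow> u * f x + scalar_product v x = 0 \<longrightarrow> u' * f x + scalar_product v' x = 0)"
proof -
  have "covered_by (codeword f u' v') (codeword f u v) \<longleftrightarrow>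
    (\<forall>i. codeword f u v $ i = 0 \<longrightarrow> codeword f u' v' $ i = 0)"
    by (auto simp: covered_by_def support_def)
  also have "\<dots> \<longleftrightarrow> (\<forall>x. x \<noteq> 0 \<longrightarrow> codeword f u v $ Abs_nonzero_vec x = 0 \<longrightarrow>
      codeword f u' v' $ Abs_nonzero_vec x = 0)"
    by (metis (mono_tags, lifting) Abs_nonzero_vec_cases mem_Collect_eq)
  finally show ?thesis
    by (simp add: codeword_nth_Abs)
qed

lemma codeword_scale: "codeword f (a * u) (a *s v) = a *s codeword f u v"
  by (simp add: codeword_def vec_eq_iff scalar_product_simps algebra_simps)

lemma minimal_codeword_iff_span:
  fixes f :: "('a::{field, finite}) ^ ('m::finite) \<Rightarrow> 'a"
  assumes f_not_linear: "\<And>\<omega>'. \<exists>x. x \<noteq> 0 \<and> f x \<noteq> scalar_product \<omega>' x"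
    and "u \<noteq> 0"
    and \<omega>: "\<omega> = (- (1 / u)) *s v"
  shows "minimal_codeword (code_of f) (codeword f u v) \<longleftrightarrow>
    vec.span {x. x \<noteq> 0 \<and> f x = scalar_product \<omega> x} = UNIV"
    (is "?min \<longleftrightarrow> vec.span ?Z = UNIV")
proof -
  \<comment> \<open>Dividing by \<open>u\<close> explains the choice of \<open>\<omega>\<close>:
    \<open>?Z\<close> is the zero set of the codeword.\<close>
  have zero: "u * f x + scalar_product v x = 0 \<longleftrightarrow> f x = scalar_product \<omega> x" for x
  proof -
    have \<omega>x: "scalar_product \<omega> x = - (scalar_product v x / u)"
      unfolding \<omega> scalar_product_scale_left by simp
    have "u * f x + scalar_product v x = u * (f x + scalar_product v x / u)"
      using \<open>u \<noteq> 0\<close> by (simp add: distrib_left)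
    then show ?thesis
      unfolding \<omega>x eq_neg_iff_add_eq_0 using \<open>u \<noteq> 0\<close> by simp
  qed
  show ?thesis
  proof
    assume min: ?min
    show "vec.span ?Z = UNIV"
    proof (rule ccontr)
      assume "vec.span ?Z \<noteq> UNIV"
      then obtain w where w: "w \<noteq> 0" "\<And>x. x \<in> ?Z \<Longrightarrow> scalar_product w x = 0"
        by (rule ex_orthogonal_if_not_spanning) blast
      have "covered_by (codeword f 0 w) (codeword f u v)"
        using w(2) by (simp add: covered_by_codeword_iff zero)
      then obtain a where a: "codeword f 0 w = a *s codeword f u v"
        using min unfolding minimal_codeword_def code_of_def by blast
      have eq: "scalar_product w x = a * (u * f x + scalar_product v x)" if "x \<noteq> 0" for x
        using arg_cong[OF a, of "\<lambda>c. c $ Abs_nonzero_vec x"] that by (simp add: codeword_nth_Abs)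
      show False
      proof (cases "a = 0")
        case True
        then have "scalar_product w x = 0" for x
          using eq by (cases "x = 0") (simp_all add: scalar_product_zero_right)
        then have "w = 0"
          by (intro scalar_product_eq_zero_on_spanning_set[OF _ vec.span_UNIV])
        then show False
          using w(1) by simp
      next
        case False
        \<comment> \<open>Solving \<open>eq\<close> for \<open>f x\<close> would make
          \<open>f\<close> agree with a linear functional at all nonzero vectors.\<close>
        have "f x = scalar_product ((1 / u) *s ((1 / a) *s w - v)) x" if "x \<noteq> 0" for x
          using eq[OF that] False \<open>u \<noteq> 0\<close> by (simp add: scalar_product_simps add_divide_distrib diff_divide_distrib)
        then show False
          using f_not_linear by blast
      qed
    qed
  next
    assume span: "vec.span ?Z = UNIV"
    have "\<exists>a. codeword f u' v' = a *s codeword f u v"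
      if "covered_by (codeword f u' v') (codeword f u v)" for u' v'
    proof -
      \<comment> \<open>On \<open>?Z\<close> the value \<open>f x\<close> may be replaced by that of
        \<open>\<omega>\<close>, so the covered codeword becomes linear in \<open>x\<close>
        there.\<close>
      have "scalar_product (u' *s \<omega> + v') x = 0" if "x \<in> ?Z" for x
        using that \<open>covered_by _ _\<close> by (auto simp: covered_by_codeword_iff zero scalar_product_simps)
      then have "u' *s \<omega> + v' = 0"
        by (rule scalar_product_eq_zero_on_spanning_set[OF _ span])
      then have "v' = - (u' *s \<omega>)"
        by (simp only: add_eq_0_iff)
      \<comment> \<open>Unfolding \<open>\<omega>\<close> shows that the single factor
        \<open>u' / u\<close> carries both \<open>u\<close> to \<open>u'\<close> and
        \<open>v\<close> to \<open>v'\<close>.\<close>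
      then have "v' = (u' / u) *s v"
        by (simp add: \<omega> vec_eq_iff)
      moreover have "u' = (u' / u) * u"
        using \<open>u \<noteq> 0\<close> by simp
      ultimately show ?thesis
        by (metis codeword_scale)
    qed
    then show ?min
      unfolding minimal_codeword_def code_of_def by blast
  qed
qed

theorem proposition3p4:
  fixes f :: "('a :: {field, finite}) ^ ('m :: finite) \<Rightarrow> 'a"
    and u :: 'a
    and v \<omega> :: "'a ^ 'm"
  assumes f_not_linear: "\<And>\<omega>' :: 'a ^ 'm. \<exists>x. x \<noteq> 0 \<and> f x \<noteq> scalar_product \<omega>' x"
    and "u \<noteq> 0"
    and "v \<noteq> 0"
    and "\<omega> = (- (1 / u)) *s v"
  shows "minimal_codeword (code_of f) (codeword f u v) \<longleftrightarrow>
    (\<exists>\<alpha> :: 'm \<Rightarrow> 'a ^ 'm.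
       inj \<alpha> \<and> vec.independent (range \<alpha>) \<and> vec.span (range \<alpha>) = UNIV \<and>
       (\<forall>i. f (\<alpha> i) = scalar_product \<omega> (\<alpha> i)))"
    (is "_ \<longleftrightarrow> ?basis")
proof -
  let ?Z = "{x. x \<noteq> 0 \<and> f x = scalar_product \<omega> x}"
  \<comment> \<open>A spanning \<open>?Z\<close> contains a basis, and conversely a basis inside
    \<open>?Z\<close> makes it span.\<close>
  have "vec.span ?Z = UNIV \<longleftrightarrow> ?basis"
  proof
    assume "vec.span ?Z = UNIV"
    then show ?basis
      by (rule ex_indexed_basis_if_spanning) blast
  next
    assume ?basis
    then obtain \<alpha> :: "'m \<Rightarrow> 'a ^ 'm" where \<alpha>: "vec.independent (range \<alpha>)"
      "vec.span (range \<alpha>) = UNIV" "\<forall>i. f (\<alpha> i) = scalar_product \<omega> (\<alpha> i)"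
      by blast
    \<comment> \<open>Membership in \<open>?Z\<close> also demands nonzero vectors, which
      independence supplies.\<close>
    have "\<alpha> i \<noteq> 0" for i
      using \<alpha>(1) vec.dependent_zero by (metis rangeI)
    then have "range \<alpha> \<subseteq> ?Z"
      using \<alpha>(3) by auto
    then show "vec.span ?Z = UNIV"
      using vec.span_mono \<alpha>(2) by blast
  qed
  then show ?thesis
    using minimal_codeword_iff_span[OF assms(1,2,4)] by simp
qed

end
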